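(* For fixed $0<\alpha<1$ and $0<\theta<1$, the equation $f(c,\alpha,\theta)=0$ has a unique positive root $c$, where, for $c>0$, $$f(c,\alpha,\theta)=\theta-1+c\int_0^{\frac{c}{1-\alpha}}e^{-cs}\left(1-s\,\frac{1-\alpha}{c}\right)^{\frac1{1-\alpha}}ds.$$ *)

theory Defs
  imports "HOL-Analysis.Analysis"
begin

(* Meaningful for c > 0 and alpha < 1.  On the range of integration the base of powr
   lies in [0,1], and it vanishes only at the upper endpoint, where 0 powr a = 0 is the
   usual value since 1 / (1 - alpha) > 0.  The integrand is then continuous, so the
   Henstock-Kurzweil integral is the ordinary Riemann integral. *)
definition f :: "real \<Rightarrow> real \<Rightarrow> real \<Rightarrow> real" where
  "f c \<alpha> \<theta> = \<theta> - 1 +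
     c * integral {0..c / (1 - \<alpha>)}
           (\<lambda>s. exp (- c * s) * (1 - s * ((1 - \<alpha>) / c)) powr (1 / (1 - \<alpha>)))"

end

(* Substituting s = c * x turns the integral term of f into k * integral of
   exp(- k x) (1 - a x)^(1/a) over [0, 1/a], with k = c^2 and a = 1 - alpha.  The factor k
   obscures its monotonicity; integrating by parts absorbs it and leaves 1 - H(k), where
   H(k) = integral of exp(- k x) (1 - a x)^(1/a - 1).  H is continuous and strictly
   decreasing with H(0) = 1 and H(k) <= 1/k, so it takes the value theta exactly once. *)
theory Submission
  imports Defs
begin

text \<open>A positive exponent keeps \<open>powr\<close> continuous where the base vanishes, so
  closed intervals ending at a zero of the base are covered.\<close>

lemma continuous_on_one_minus_mult_powr:
  fixes c p :: real
  assumes "p > 0" "\<And>x. x \<in> S \<Longrightarrow> c * x \<le> 1"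
  shows "continuous_on S (\<lambda>x. (1 - c * x) powr p)"
  using assms by (intro continuous_on_powr' continuous_intros) auto

definition exp_powr_integral :: "real \<Rightarrow> real \<Rightarrow> real" where
  "exp_powr_integral a k =
     integral {0..1/a} (\<lambda>x. exp (- k * x) * (1 - a * x) powr (1 / a - 1))"

lemma continuous_on_exp_powr:
  fixes a k :: real
  assumes "0 < a" "a < 1"
  shows "continuous_on {0..1/a} (\<lambda>x. exp (- k * x) * (1 - a * x) powr (1 / a - 1))"
  using assms
  by (intro continuous_intros continuous_on_one_minus_mult_powr) (auto simp: field_simps)

lemma integrable_exp_powr:
  fixes a k :: real
  assumes "0 < a" "a < 1"
  shows "(\<lambda>x. exp (- k * x) * (1 - a * x) powr (1 / a - 1)) integrable_on {0..1/a}"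
  by (intro integrable_continuous_interval continuous_on_exp_powr assms)

text \<open>Keeping the factor \<open>k\<close> inside the integrand avoids division by
  \<open>k\<close>, so the identity also covers \<open>k = 0\<close>.\<close>

lemma integral_exp_powr_by_parts:
  fixes k a :: real
  assumes "0 < a" "a < 1"
  shows "((\<lambda>x. k * (exp (- k * x) * (1 - a * x) powr (1 / a)))
           has_integral 1 - exp_powr_integral a k) {0..1/a}"
proof -
  let ?h = "\<lambda>x. exp (- k * x) * (1 - a * x) powr (1 / a - 1)"
  have le1: "a * x \<le> 1" if "x \<in> {0..1/a}" for x
    using that assms by (simp add: field_simps)
  have pos: "1 / a > 0"
    using assms by simp
  have h: "(?h has_integral exp_powr_integral a k) {0..1/a}"
    unfolding exp_powr_integral_def by (intro integrable_integral integrable_exp_powr assms)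
  let ?F = "\<lambda>x. - (exp (- k * x) * (1 - a * x) powr (1 / a))"
  let ?G = "\<lambda>x. k * (exp (- k * x) * (1 - a * x) powr (1 / a))"
  \<comment> \<open>By the product rule the derivative of \<open>?F\<close> is
    \<open>?G + ?h\<close>. The boundary values are 0 at \<open>1/a\<close>, since
    \<open>0 powr (1/a) = 0\<close>, and -1 at 0. Differentiating only in the interior keeps the
    base of \<open>powr\<close> positive.\<close>
  have "((\<lambda>x. ?G x + ?h x) has_integral (?F (1/a) - ?F 0)) {0..1/a}"
  proof (rule fundamental_theorem_of_calculus_interior)
    show "continuous_on {0..1/a} ?F"
      by (intro continuous_intros continuous_on_one_minus_mult_powr pos le1)
    fix x assume "x \<in> {0<..<1/a}"
    then have x: "1 - a * x > 0"
      using assms by (auto simp: field_simps)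
    have "(?F has_real_derivative
        - (exp (- k * x) * ((1 / a) * (1 - a * x) powr (1 / a - 1) * (- a))
           + (exp (- k * x) * (- k)) * (1 - a * x) powr (1 / a))) (at x)"
      using x by (auto intro!: derivative_eq_intros)
    also have "- (exp (- k * x) * ((1 / a) * (1 - a * x) powr (1 / a - 1) * (- a))
           + (exp (- k * x) * (- k)) * (1 - a * x) powr (1 / a)) = ?G x + ?h x"
      using assms by (simp add: field_simps)
    finally show "(?F has_vector_derivative (?G x + ?h x)) (at x)"
      by (simp add: has_real_derivative_iff_has_vector_derivative)
  qed (use assms in auto)
  from has_integral_diff[OF this h] show ?thesis
    using assms by simp
qed

text \<open>At \<open>k = 0\<close> the integrand of the by-parts identity vanishes, which forces
  its value \<open>1 - exp_powr_integral a 0\<close> to be 0.\<close>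

lemma exp_powr_integral_0:
  assumes "0 < a" "a < 1"
  shows "exp_powr_integral a 0 = 1"
  using has_integral_unique[OF integral_exp_powr_by_parts[OF assms, of 0], of 0] by simp

lemma exp_powr_integral_strict_antimono:
  assumes "0 < a" "a < 1" "k < l"
  shows "exp_powr_integral a l < exp_powr_integral a k"
  unfolding exp_powr_integral_def
proof (intro integral_less_real continuous_on_exp_powr assms)
  \<comment> \<open>Strictness holds only in the interior: the two integrands agree at both
    endpoints.\<close>
  fix x assume "x \<in> {0<..<1/a}"
  then have "1 - a * x > 0" "x > 0"
    using assms by (auto simp: field_simps)
  then show "exp (- l * x) * (1 - a * x) powr (1 / a - 1)
      < exp (- k * x) * (1 - a * x) powr (1 / a - 1)"
    using assms by simp
qed (use assms in simp)

text \<open>The \<open>powr\<close> factor is at most 1, and the exponential alone integrates to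
  \<open>(1 - exp (- k / a)) / k\<close>.\<close>

lemma exp_powr_integral_le:
  assumes "0 < a" "a < 1" "k > 0"
  shows "exp_powr_integral a k \<le> 1 / k"
proof -
  have "((\<lambda>x. exp (- k * x)) has_integral
      (- exp (- k * (1/a)) / k - (- exp (- k * 0) / k))) {0..1/a}"
    using assms
    by (intro fundamental_theorem_of_calculus)
      (auto intro!: derivative_eq_intros
        simp flip: has_real_derivative_iff_has_vector_derivative)
  then have "exp_powr_integral a k \<le> - exp (- k * (1/a)) / k - (- exp (- k * 0) / k)"
    unfolding exp_powr_integral_def
  proof (rule has_integral_le[OF integrable_integral[OF integrable_exp_powr[OF assms(1,2)]]])
    fix x assume "x \<in> {0..1/a}"
    then have "(1 - a * x) powr (1 / a - 1) \<le> 1"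
      using assms by (intro powr_le1) (auto simp: field_simps)
    then show "exp (- k * x) * (1 - a * x) powr (1 / a - 1) \<le> exp (- k * x)"
      by (intro mult_left_le) auto
  qed
  also have "\<dots> \<le> 1 / k"
    using assms by simp
  finally show ?thesis .
qed

lemma continuous_on_exp_powr_integral:
  assumes "0 < a" "a < 1"
  shows "continuous_on S (exp_powr_integral a)"
  unfolding exp_powr_integral_def[abs_def] box_real(2)[symmetric]
proof (rule integral_continuous_on_param)
  show "continuous_on (S \<times> cbox 0 (1/a))
      (\<lambda>(k, x). exp (- k * x) * (1 - a * x) powr (1 / a - 1))"
    unfolding case_prod_unfold using assms
    by (intro continuous_intros continuous_on_powr') (auto simp: field_simps)
qed

lemma f_eq:
  fixes c \<alpha> \<theta> :: real
  assumes "0 < \<alpha>" "\<alpha> < 1" "c > 0"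
  shows "f c \<alpha> \<theta> = \<theta> - exp_powr_integral (1 - \<alpha>) (c\<^sup>2)"
    (is "_ = \<theta> - ?I")
proof -
  let ?g = "\<lambda>x. c\<^sup>2 * (exp (- c\<^sup>2 * x) * (1 - (1 - \<alpha>) * x) powr (1 / (1 - \<alpha>)))"
  let ?j = "\<lambda>s. exp (- c * s) * (1 - s * ((1 - \<alpha>) / c)) powr (1 / (1 - \<alpha>))"
  have "(?g has_integral 1 - ?I) (cbox 0 (1 / (1 - \<alpha>)))"
    using integral_exp_powr_by_parts[of "1 - \<alpha>" "c\<^sup>2"] assms by simp
  \<comment> \<open>Substituting \<open>x = s / c\<close> stretches the interval to the one in
    \<open>f\<close> and multiplies the integral by \<open>c\<close>.\<close>
  from has_integral_affinity'[OF this, of "1/c" 0]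
  have "((\<lambda>s. ?g (s / c)) has_integral c * (1 - ?I)) {0..c / (1 - \<alpha>)}"
    using assms by (simp add: field_simps)
  also have "(\<lambda>s. ?g (s / c)) = (\<lambda>s. c\<^sup>2 * ?j s)"
    using assms by (simp add: power2_eq_square mult_ac)
  finally have "integral {0..c / (1 - \<alpha>)} (\<lambda>s. c\<^sup>2 * ?j s) = c * (1 - ?I)"
    by (rule integral_unique)
  then have "c * (c * integral {0..c / (1 - \<alpha>)} ?j) = c * (1 - ?I)"
    unfolding integral_mult_right by (simp add: power2_eq_square)
  then show ?thesis
    using assms unfolding f_def by simp
qed

theorem lemma8p2:
  fixes \<alpha> \<theta> :: real
  assumes "0 < \<alpha>" "\<alpha> < 1" and "0 < \<theta>" "\<theta> < 1"
  shows "\<exists>!c::real. c > 0 \<and> f c \<alpha> \<theta> = 0"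
proof -
  define a where "a = 1 - \<alpha>"
  have a: "0 < a" "a < 1"
    using assms by (auto simp: a_def)
  define H where "H = exp_powr_integral a"
  have f: "f c \<alpha> \<theta> = \<theta> - H (c\<^sup>2)" if "c > 0" for c
    using f_eq[OF assms(1,2) that] by (simp add: H_def a_def)
  have H0: "H 0 = 1"
    using exp_powr_integral_0[OF a] by (simp add: H_def)
  \<comment> \<open>The point \<open>1/\<theta>\<close> is where the bound \<open>1 / k\<close>
    equals \<theta>, so 0 and \<open>1/\<theta>\<close> bracket the root.\<close>
  have "H (1/\<theta>) \<le> \<theta>" "\<theta> \<le> H 0"
    using H0 exp_powr_integral_le[OF a, of "1/\<theta>"] assms by (auto simp: H_def)
  then obtain k where k: "k \<ge> 0" "H k = \<theta>"
    using IVT2'[of H "1/\<theta>" \<theta> 0] continuous_on_exp_powr_integral[OF a] assms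
    by (auto simp: H_def)
  \<comment> \<open>The intermediate value theorem gives only \<open>k \<ge> 0\<close>; the value 0
    is excluded because \<open>H 0 = 1\<close> exceeds \<theta>.\<close>
  with H0 assms have "k > 0"
    by (cases "k = 0") auto
  show ?thesis
  proof (rule ex1I)
    show "sqrt k > 0 \<and> f (sqrt k) \<alpha> \<theta> = 0"
      using \<open>k > 0\<close> k f[of "sqrt k"] by simp
    fix c assume c: "c > 0 \<and> f c \<alpha> \<theta> = 0"
    then have "H (c\<^sup>2) = H k"
      using f[of c] k by simp
    then have "c\<^sup>2 = k"
      using exp_powr_integral_strict_antimono[OF a] unfolding H_def
      by (metis linorder_neq_iff order_less_irrefl)
    then show "c = sqrt k"
      using c by (simp add: real_sqrt_unique)
  qed
qed

end
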